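(* Let $\mathcal{H}$ be a complex separable Hilbert space, let $T \in \mathscr{B}(\mathcal{H})$ be an idempotent, and let $\mathcal{S}$ be a closed subspace of $\mathcal{H}$. Then $\mathcal{S}$ is invariant under $T$ if and only if $\mathcal{S}$ is invariant under the operator $(P_{\mathcal{N}(T^* )}|_{\mathcal{N}(T)})^{-1} P_{\mathcal{N}(T^* )}$ on $\mathcal{H}$.
   Context: $\mathscr{B}(\mathcal{H})$ denotes the algebra of bounded linear operators on $\mathcal{H}$. $T$ is idempotent if $T^2 = T$ (not necessarily self-adjoint). $\mathcal{N}(T)$ is the null space of $T$, and $\mathcal{N}(T^* ) = \mathcal{R}(T)^\perp$, where $\mathcal{R}(T)$ is the range of $T$. For a closed subspace $\mathcal{M} \subseteq \mathcal{H}$, $P_{\mathcal{M}}$ is the orthogonal projection onto $\mathcal{M}$. For an idempotent $T$, the restriction $P_{\mathcal{N}(T^* )}|_{\mathcal{N}(T)} : \mathcal{N}(T) \to \mathcal{N}(T^* )$ is known to be a bounded invertible operator; its inverse $\mathcal{N}(T^* ) \to \mathcal{N}(T) \subseteq \mathcal{H}$ composed with $P_{\mathcal{N}(T^* )} : \mathcal{H} \to \mathcal{N}(T^* )$ is regarded as an operator on $\mathcal{H}$. A closed subspace $\mathcal{S}$ is invariant under $X$ if $X\mathcal{S} \subseteq \mathcal{S}$. *)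

theory Defs
  imports "HOL-Analysis.Analysis"
begin

class complex_vector = real_vector +
  fixes scaleC :: "complex \<Rightarrow> 'a \<Rightarrow> 'a"  (infixr "*\<^sub>C" 75)
  assumes scaleC_add_right: "a *\<^sub>C (x + y) = a *\<^sub>C x + a *\<^sub>C y"
    and scaleC_add_left: "(a + b) *\<^sub>C x = a *\<^sub>C x + b *\<^sub>C x"
    and scaleC_scaleC: "a *\<^sub>C b *\<^sub>C x = (a * b) *\<^sub>C x"
    and scaleC_one: "1 *\<^sub>C x = x"
    and scaleR_scaleC: "r *\<^sub>R x = complex_of_real r *\<^sub>C x"

global_interpretation complex_vector: vector_space "scaleC :: complex \<Rightarrow> 'a \<Rightarrow> 'a :: complex_vector"
  by unfold_locales (rule scaleC_add_right scaleC_add_left scaleC_scaleC scaleC_one)+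

text \<open>The inner product is linear in its first and conjugate-linear in its second argument.\<close>

class complex_inner = complex_vector + real_normed_vector +
  fixes cinner :: "'a \<Rightarrow> 'a \<Rightarrow> complex"
  assumes cinner_add_left: "cinner (x + y) z = cinner x z + cinner y z"
    and cinner_scaleC_left: "cinner (c *\<^sub>C x) y = c * cinner x y"
    and cinner_commute: "cinner x y = cnj (cinner y x)"
    and cinner_self_nonneg: "0 \<le> Re (cinner x x)"
    and cinner_self_eq_zero_iff: "cinner x x = 0 \<longleftrightarrow> x = 0"
    and norm_eq_sqrt_cinner: "norm x = sqrt (Re (cinner x x))"

class chilbert_space = complex_inner + complete_space

instantiation complex :: chilbert_space
begin

definition scaleC_complex :: "complex \<Rightarrow> complex \<Rightarrow> complex"
  where "scaleC_complex = (*)"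

definition cinner_complex :: "complex \<Rightarrow> complex \<Rightarrow> complex"
  where "cinner_complex x y = x * cnj y"

instance
proof
  fix x :: complex
  have sq: "x * cnj x = complex_of_real ((cmod x)\<^sup>2)"
    by (rule complex_norm_square [symmetric])
  show "0 \<le> Re (cinner x x)" "norm x = sqrt (Re (cinner x x))"
    by (simp_all add: cinner_complex_def sq)
  show "cinner x x = 0 \<longleftrightarrow> x = 0"
    by (simp add: cinner_complex_def)
qed (simp_all add: scaleC_complex_def cinner_complex_def scaleR_conv_of_real algebra_simps)

end

definition bounded_clinear :: "('a::complex_inner \<Rightarrow> 'a) \<Rightarrow> bool"
  where "bounded_clinear T \<longleftrightarrow> bounded_linear T \<and> (\<forall>c x. T (c *\<^sub>C x) = c *\<^sub>C T x)"

definition closed_csubspace :: "'a::complex_inner set \<Rightarrow> bool"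
  where "closed_csubspace S \<longleftrightarrow> complex_vector.subspace S \<and> closed S"

definition null_space :: "('a::zero \<Rightarrow> 'a) \<Rightarrow> 'a set"
  where "null_space T = {x. T x = 0}"

definition cadjoint :: "('a::complex_inner \<Rightarrow> 'a) \<Rightarrow> 'a \<Rightarrow> 'a"
  where "cadjoint T = (THE R. \<forall>x y. cinner (T x) y = cinner x (R y))"

definition orth_proj :: "'a::complex_inner set \<Rightarrow> 'a \<Rightarrow> 'a"
  where "orth_proj M x = (THE y. y \<in> M \<and> (\<forall>z\<in>M. cinner (x - y) z = 0))"

definition idempotent :: "('a \<Rightarrow> 'a) \<Rightarrow> bool"
  where "idempotent T \<longleftrightarrow> T \<circ> T = T"

definition invariant_under :: "'a set \<Rightarrow> ('a \<Rightarrow> 'a) \<Rightarrow> bool"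
  where "invariant_under S X \<longleftrightarrow> X ` S \<subseteq> S"

text \<open>
  The operator \<open>(P\<^bsub>N(T*)\<^esub>|\<^bsub>N(T)\<^esub>)\<^sup>-\<^sup>1 P\<^bsub>N(T*)\<^esub>\<close> on the whole space: \<open>the_inv_into (null_space T) P\<close> is the
  inverse of the restriction of \<open>P\<close> to \<open>null_space T\<close>, with values in \<open>null_space T\<close>. For a bounded
  idempotent \<open>T\<close> this restriction is a bijection onto \<open>null_space (cadjoint T)\<close>, so the inverse is
  only applied where it is meaningful.
\<close>

definition restricted_inverse_proj :: "('a::complex_inner \<Rightarrow> 'a) \<Rightarrow> 'a \<Rightarrow> 'a"
  where "restricted_inverse_proj T =
    (let P = orth_proj (null_space (cadjoint T)) in the_inv_into (null_space T) P \<circ> P)"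

end

theory Submission
  imports Defs
begin

text \<open>
  For an idempotent \<open>T\<close> the operator \<open>(P\<^bsub>N(T*)\<^esub>|\<^bsub>N(T)\<^esub>)\<^sup>-\<^sup>1 P\<^bsub>N(T*)\<^esub>\<close> is simply \<open>I - T\<close>: the projection
  onto \<open>N(T*) = R(T)\<^sup>\<bottom>\<close> kills \<open>T x\<close>, hence sends \<open>x\<close> and \<open>x - T x \<in> N(T)\<close> to the same vector, and it is
  injective on \<open>N(T)\<close> because \<open>N(T) \<inter> R(T) = 0\<close>. A subspace is invariant under \<open>T\<close> if and only if it is
  invariant under \<open>I - T\<close>.
\<close>

section \<open>Complex inner products\<close>

lemma cinner_add_right: "cinner x (y + z) = cinner x y + cinner x z"
  by (metis cinner_add_left cinner_commute complex_cnj_add)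

lemma cinner_scaleC_right: "cinner x (c *\<^sub>C y) = cnj c * cinner x y"
  by (metis cinner_scaleC_left cinner_commute complex_cnj_mult)

lemma cinner_zero_left [simp]: "cinner 0 y = 0"
  using cinner_add_left[of 0 0 y] by simp

lemma cinner_zero_right [simp]: "cinner x 0 = 0"
  using cinner_add_right[of x 0 0] by simp

lemma cinner_diff_left: "cinner (x - y) z = cinner x z - cinner y z"
  using cinner_add_left[of "x - y" y z] by simp

lemma cinner_diff_right: "cinner x (y - z) = cinner x y - cinner x z"
  using cinner_add_right[of x "y - z" z] by simp

lemma cinner_self_norm: "cinner x x = complex_of_real ((norm x)\<^sup>2)"
proof -
  have "Im (cinner x x) = 0"
    using cinner_commute[of x x] by (simp add: complex_eq_iff)
  then show ?thesis
    by (simp add: complex_eq_iff norm_eq_sqrt_cinner cinner_self_nonneg)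
qed

lemma cinner_left_ext:
  assumes "\<And>x. cinner x y = cinner x z"
  shows "y = z"
  using assms[of "y - z"] cinner_self_eq_zero_iff[of "y - z"] by (simp add: cinner_diff_right)

lemma parallelogram_law:
  fixes a b :: "'a::complex_inner"
  shows "(norm (a + b))\<^sup>2 + (norm (a - b))\<^sup>2 = 2 * (norm a)\<^sup>2 + 2 * (norm b)\<^sup>2"
proof -
  \<comment> \<open>The identity is lifted to the complex numbers, where each squared norm is an
    inner product of a vector with itself and the cross terms cancel.\<close>
  have "complex_of_real ((norm (a + b))\<^sup>2 + (norm (a - b))\<^sup>2)
      = complex_of_real (2 * (norm a)\<^sup>2 + 2 * (norm b)\<^sup>2)"
    unfolding of_real_add of_real_mult cinner_self_norm[symmetric]
    by (simp add: cinner_add_left cinner_add_right cinner_diff_left cinner_diff_right)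
  then show ?thesis
    by (simp only: of_real_eq_iff)
qed

text \<open>Pythagoras for removing from \<open>w\<close> its component along \<open>z\<close>. It
  serves twice: the left side being nonnegative gives Cauchy-Schwarz, and the strict decrease for a
  nonzero component makes nearest points orthogonal.\<close>

lemma norm_sq_subtract_component:
  fixes w z :: "'a::complex_inner"
  assumes "z \<noteq> 0"
  shows "(norm (w - (cinner w z / cinner z z) *\<^sub>C z))\<^sup>2 = (norm w)\<^sup>2 - (cmod (cinner w z))\<^sup>2 / (norm z)\<^sup>2"
proof -
  define c where "c = cinner w z / cinner z z"
  have nz: "cinner z z \<noteq> 0"
    using assms by (simp add: cinner_self_eq_zero_iff)
  have "cinner (w - c *\<^sub>C z) z = 0"
    using nz by (simp add: cinner_diff_left cinner_scaleC_left c_def)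
  \<comment> \<open>The remainder is orthogonal to \<open>z\<close>, so the multiple of
    \<open>z\<close> in the second argument contributes nothing.\<close>
  then have "cinner (w - c *\<^sub>C z) (w - c *\<^sub>C z) = cinner (w - c *\<^sub>C z) w"
    by (simp add: cinner_diff_right[of "w - c *\<^sub>C z"] cinner_scaleC_right)
  also have "\<dots> = cinner w w - cinner w z * cnj (cinner w z) / cinner z z"
    by (simp add: cinner_diff_left cinner_scaleC_left c_def cinner_commute[of z w])
  finally have "complex_of_real ((norm (w - c *\<^sub>C z))\<^sup>2)
      = complex_of_real ((norm w)\<^sup>2 - (cmod (cinner w z))\<^sup>2 / (norm z)\<^sup>2)"
    by (simp only: cinner_self_norm complex_norm_square[symmetric] of_real_diff of_real_divide)
  then show ?thesis
    by (simp only: of_real_eq_iff c_def)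
qed

lemma cinner_Cauchy_Schwarz: "cmod (cinner x y) \<le> norm x * norm y"
proof (cases "y = 0")
  case False
  have "(cmod (cinner x y))\<^sup>2 / (norm y)\<^sup>2 \<le> (norm x)\<^sup>2"
    using norm_sq_subtract_component[OF False, of x]
      zero_le_power2[of "norm (x - (cinner x y / cinner y y) *\<^sub>C y)"] by linarith
  then have "(cmod (cinner x y))\<^sup>2 \<le> (norm x * norm y)\<^sup>2"
    using False by (simp add: divide_le_eq power_mult_distrib)
  then show ?thesis
    by (rule power2_le_imp_le) simp
qed simp

lemma bounded_linear_cinner_left: "bounded_linear (\<lambda>x. cinner x y)"
  by (rule bounded_linear_intro[where K = "norm y"])
    (simp_all add: cinner_add_left scaleR_scaleC scaleC_complex_def cinner_scaleC_left
      cinner_Cauchy_Schwarz)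

section \<open>Orthogonal projections\<close>

text \<open>A minimizing sequence in \<open>M\<close> is Cauchy by the parallelogram law;
  completeness gives a limit, which stays in \<open>M\<close> because \<open>M\<close> is
  closed.\<close>

lemma nearest_point_exists:
  fixes M :: "'a::chilbert_space set"
  assumes M: "closed_csubspace M"
  obtains y where "y \<in> M" "\<And>z. z \<in> M \<Longrightarrow> (norm (x - y))\<^sup>2 \<le> (norm (x - z))\<^sup>2"
proof -
  have sub: "complex_vector.subspace M" and cl: "closed M"
    using M by (auto simp: closed_csubspace_def)
  define D where "D = (\<lambda>y. (norm (x - y))\<^sup>2) ` M"
  define d where "d = Inf D"
  have "0 \<in> M"
    using sub by (rule complex_vector.subspace_0)
  then have D_ne: "D \<noteq> {}"
    by (auto simp: D_def)
  have "bdd_below D"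
    unfolding D_def by (intro bdd_belowI2[where m = 0]) simp
  then have d_le: "d \<le> (norm (x - z))\<^sup>2" if "z \<in> M" for z
    unfolding d_def using that by (intro cInf_lower) (auto simp: D_def)
  have "\<exists>y\<in>M. (norm (x - y))\<^sup>2 < d + inverse (real (Suc n))" for n
  proof -
    have "Inf D < d + inverse (real (Suc n))"
      by (simp add: d_def)
    from cInf_lessD[OF D_ne this] show ?thesis
      by (auto simp: D_def)
  qed
  then obtain y where yM: "\<And>n. y n \<in> M"
    and yd: "\<And>n. (norm (x - y n))\<^sup>2 < d + inverse (real (Suc n))"
    by metis
  have diff: "(norm (y m - y n))\<^sup>2 \<le> 2 * inverse (real (Suc m)) + 2 * inverse (real (Suc n))" for m n
  proof -
    \<comment> \<open>The midpoint \<open>u\<close> lies in \<open>M\<close>, so the term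
      \<open>4 * (norm (x - u))\<^sup>2\<close> of the parallelogram law is at least
      \<open>4 * d\<close> and absorbs the \<open>d\<close> from both upper bounds.\<close>
    define u where "u = (1/2 :: complex) *\<^sub>C (y m + y n)"
    have "u \<in> M"
      unfolding u_def using sub yM by (intro complex_vector.subspace_scale complex_vector.subspace_add)
    moreover have "y m + y n = 2 *\<^sub>R u"
      by (simp add: u_def scaleR_scaleC scaleC_scaleC scaleC_one)
    then have "(x - y m) + (x - y n) = 2 *\<^sub>R (x - u)"
      by (simp add: scaleR_right_diff_distrib scaleR_2 algebra_simps)
    then have "(norm ((x - y m) + (x - y n)))\<^sup>2 = 4 * (norm (x - u))\<^sup>2"
      by (simp add: power_mult_distrib)
    moreover have "norm ((x - y m) - (x - y n)) = norm (y m - y n)"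
      by (simp add: norm_minus_commute)
    ultimately show ?thesis
      using parallelogram_law[of "x - y m" "x - y n"] d_le[of u] yd[of m] yd[of n] by simp
  qed
  have "Cauchy y"
  proof (rule metric_CauchyI)
    fix e :: real
    assume e: "0 < e"
    \<comment> \<open>Both summands of \<open>diff\<close> carry a factor 2, so the bound
      \<open>e\<^sup>2 / 4\<close> on each inverse makes the sum less than
      \<open>e\<^sup>2\<close>.\<close>
    then obtain N where N: "inverse (real (Suc N)) < e\<^sup>2 / 4"
      using reals_Archimedean[of "e\<^sup>2 / 4"] by auto
    have small: "inverse (real (Suc n)) < e\<^sup>2 / 4" if "N \<le> n" for n
      using that le_imp_inverse_le[of "real (Suc N)" "real (Suc n)"] N by linarith
    have "dist (y m) (y n) < e" if "N \<le> m" "N \<le> n" for m n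
    proof -
      have "(norm (y m - y n))\<^sup>2 < e\<^sup>2"
        using diff[of m n] small[OF that(1)] small[OF that(2)] by linarith
      then show ?thesis
        using e by (simp add: dist_norm power2_less_imp_less)
    qed
    then show "\<exists>N. \<forall>m\<ge>N. \<forall>n\<ge>N. dist (y m) (y n) < e"
      by blast
  qed
  then obtain l where l: "y \<longlonglongrightarrow> l"
    using Cauchy_convergent convergentD by blast
  have "l \<in> M"
    using closed_sequentially[OF cl _ l] yM by blast
  have "(\<lambda>n. (norm (x - y n))\<^sup>2) \<longlonglongrightarrow> (norm (x - l))\<^sup>2"
    by (intro tendsto_intros l)
  moreover have "(\<lambda>n. d + inverse (real (Suc n))) \<longlonglongrightarrow> d + 0"
    by (intro tendsto_intros LIMSEQ_inverse_real_of_nat)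
  ultimately have "(norm (x - l))\<^sup>2 \<le> d + 0"
    by (rule LIMSEQ_le) (use yd less_imp_le in blast)
  then have "(norm (x - l))\<^sup>2 \<le> (norm (x - z))\<^sup>2" if "z \<in> M" for z
    using d_le[OF that] by linarith
  with \<open>l \<in> M\<close> show thesis
    by (rule that)
qed

text \<open>Take \<open>y\<close> nearest to \<open>x\<close>: if \<open>x - y\<close> had a nonzero
  component along some \<open>z\<close> in \<open>M\<close>, adding that component to
  \<open>y\<close> would bring it strictly closer to \<open>x\<close>.\<close>

theorem orthogonal_decomposition:
  fixes M :: "'a::chilbert_space set"
  assumes M: "closed_csubspace M"
  obtains y where "y \<in> M" "\<And>z. z \<in> M \<Longrightarrow> cinner (x - y) z = 0"
proof -
  obtain y where y: "y \<in> M" and min: "\<And>z. z \<in> M \<Longrightarrow> (norm (x - y))\<^sup>2 \<le> (norm (x - z))\<^sup>2"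
    using nearest_point_exists[OF M] by blast
  have "cinner (x - y) z = 0" if z: "z \<in> M" for z
  proof (cases "z = 0")
    case False
    define c where "c = cinner (x - y) z / cinner z z"
    have "y + c *\<^sub>C z \<in> M"
      using M y z unfolding closed_csubspace_def
      by (intro complex_vector.subspace_add complex_vector.subspace_scale) auto
    from min[OF this] have "(norm (x - y))\<^sup>2 \<le> (norm ((x - y) - c *\<^sub>C z))\<^sup>2"
      by (simp add: diff_diff_eq)
    then have "(cmod (cinner (x - y) z))\<^sup>2 / (norm z)\<^sup>2 \<le> 0"
      using norm_sq_subtract_component[OF False, of "x - y"] unfolding c_def by linarith
    then show ?thesis
      using False by (simp add: divide_le_0_iff)
  qed simp
  with y show thesis
    using that by blast
qed

text \<open>Two candidates for the projection differ by a vector of \<open>M\<close> that is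
  orthogonal to itself, so the description in \<open>orth_proj\<close> is unique.\<close>

lemma orth_proj_eqI:
  assumes M: "complex_vector.subspace M"
    and y: "y \<in> M" "\<And>z. z \<in> M \<Longrightarrow> cinner (x - y) z = 0"
  shows "orth_proj M x = y"
  unfolding orth_proj_def
proof (rule the_equality)
  fix y'
  assume y': "y' \<in> M \<and> (\<forall>z\<in>M. cinner (x - y') z = 0)"
  then have "y' - y \<in> M"
    using M y by (blast intro: complex_vector.subspace_diff)
  then have "cinner (x - y) (y' - y) - cinner (x - y') (y' - y) = 0"
    using y y' by simp
  then show "y' = y"
    by (simp add: cinner_diff_left[symmetric] cinner_self_eq_zero_iff)
qed (use y in blast)

section \<open>Adjoints\<close>

text \<open>A nonzero \<open>f\<close> has a closed kernel, and a vector \<open>w\<close> orthogonal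
  to it with \<open>f w\<close> nonzero represents \<open>f\<close> up to a scalar.\<close>

lemma Riesz_representation:
  fixes f :: "'a::chilbert_space \<Rightarrow> complex"
  assumes f: "bounded_linear f" and fC: "\<And>c x. f (c *\<^sub>C x) = c * f x"
  obtains v where "\<And>x. f x = cinner x v"
proof (cases "\<forall>x. f x = 0")
  case True
  then show thesis
    using that[of 0] by simp
next
  case False
  then obtain u where u: "f u \<noteq> 0"
    by blast
  interpret bounded_linear f
    by (rule f)
  define K where "K = {x. f x = 0}"
  have "closed K"
    unfolding K_def by (intro closed_Collect_eq continuous_intros linear_continuous_on f)
  moreover have "complex_vector.subspace K"
    by (auto simp: complex_vector.subspace_def K_def zero add fC)
  ultimately have "closed_csubspace K"
    by (simp add: closed_csubspace_def)
  then obtain k where k: "k \<in> K" and orth: "\<And>z. z \<in> K \<Longrightarrow> cinner (u - k) z = 0"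
    using orthogonal_decomposition by blast
  define w where "w = u - k"
  have fw: "f w \<noteq> 0"
    using u k by (simp add: w_def K_def diff)
  have "w \<noteq> 0"
    using fw zero by auto
  then have ww: "cinner w w \<noteq> 0"
    by (simp add: cinner_self_eq_zero_iff)
  have "f x = cinner x (cnj (f w / cinner w w) *\<^sub>C w)" for x
  proof -
    \<comment> \<open>This combination is chosen to be annihilated by \<open>f\<close>; its
      orthogonality to \<open>w\<close> then solves for \<open>f x\<close>. The conjugate on the
      scalar offsets conjugate-linearity in the second argument.\<close>
    have "f x *\<^sub>C w - f w *\<^sub>C x \<in> K"
      by (simp add: K_def diff fC)
    then have "cinner (f x *\<^sub>C w - f w *\<^sub>C x) w = 0"
      using orth cinner_commute unfolding w_def by (metis complex_cnj_zero)
    then show ?thesis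
      using ww by (simp add: cinner_diff_left cinner_scaleC_left cinner_scaleC_right field_simps)
  qed
  then show thesis
    by (rule that)
qed

text \<open>Riesz representation for each fixed \<open>y\<close> gives existence, and
  \<open>cinner_left_ext\<close> gives uniqueness, so the description in \<open>cadjoint\<close>
  denotes the adjoint.\<close>

lemma cinner_cadjoint:
  fixes T :: "'a::chilbert_space \<Rightarrow> 'a"
  assumes T: "bounded_clinear T"
  shows "cinner (T x) y = cinner x (cadjoint T y)"
proof -
  have "\<exists>v. \<forall>x. cinner (T x) y = cinner x v" for y
  proof -
    have "bounded_linear (\<lambda>x. cinner (T x) y)"
      by (rule bounded_linear_compose[OF bounded_linear_cinner_left])
        (use T in \<open>simp add: bounded_clinear_def\<close>)
    moreover have "cinner (T (c *\<^sub>C x)) y = c * cinner (T x) y" for c x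
      using T by (simp add: bounded_clinear_def cinner_scaleC_left)
    ultimately show ?thesis
      by (rule Riesz_representation) blast
  qed
  then obtain R where R: "\<forall>x y. cinner (T x) y = cinner x (R y)"
    by metis
  have "cadjoint T = R"
    unfolding cadjoint_def
  proof (rule the_equality)
    show "\<forall>x y. cinner (T x) y = cinner x (R y)"
      by (rule R)
  next
    fix R'
    assume "\<forall>x y. cinner (T x) y = cinner x (R' y)"
    with R have "cinner x (R' y) = cinner x (R y)" for x y
      by simp
    then have "R' y = R y" for y
      by (rule cinner_left_ext)
    then show "R' = R"
      by (rule ext)
  qed
  with R show ?thesis
    by simp
qed

lemma null_space_cadjoint:
  fixes T :: "'a::chilbert_space \<Rightarrow> 'a"
  assumes "bounded_clinear T"
  shows "null_space (cadjoint T) = {y. \<forall>x. cinner (T x) y = 0}"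
proof -
  have "cadjoint T y = 0 \<longleftrightarrow> (\<forall>x. cinner x (cadjoint T y) = 0)" for y
    by (metis cinner_self_eq_zero_iff cinner_zero_right)
  then show ?thesis
    by (simp add: null_space_def cinner_cadjoint[OF assms])
qed

section \<open>Idempotents\<close>

text \<open>The range of an idempotent is its set of fixed points, which is closed by continuity.
  This allows orthogonal decomposition along the range.\<close>

lemma closed_csubspace_range_idempotent:
  fixes T :: "'a::chilbert_space \<Rightarrow> 'a"
  assumes T: "bounded_clinear T" and idem: "idempotent T"
  shows "closed_csubspace (range T)"
proof -
  have bl: "bounded_linear T" and TC: "\<And>c x. T (c *\<^sub>C x) = c *\<^sub>C T x"
    using T by (auto simp: bounded_clinear_def)
  interpret bounded_linear T
    by (rule bl)
  have "T (T x) = T x" for x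
    using idem by (metis idempotent_def comp_apply)
  then have range: "range T = {x. T x = x}"
    by (auto intro: range_eqI[OF sym])
  have "closed {x. T x = x}"
    by (intro closed_Collect_eq continuous_intros linear_continuous_on bl)
  then show ?thesis
    by (auto simp: range closed_csubspace_def complex_vector.subspace_def zero add TC)
qed

theorem restricted_inverse_proj_idempotent:
  fixes T :: "'a::chilbert_space \<Rightarrow> 'a"
  assumes T: "bounded_clinear T" and idem: "idempotent T"
  shows "restricted_inverse_proj T x = x - T x"
proof -
  interpret bounded_linear T
    using T by (simp add: bounded_clinear_def)
  have TT: "T (T z) = T z" for z
    using idem by (metis idempotent_def comp_apply)
  define N where "N = null_space (cadjoint T)"
  have N: "N = {y. \<forall>x. cinner (T x) y = 0}"
    by (simp add: N_def null_space_cadjoint[OF T])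
  have subN: "complex_vector.subspace N"
    by (simp add: complex_vector.subspace_def N cinner_add_right cinner_scaleC_right)
  have range: "closed_csubspace (range T)"
    by (rule closed_csubspace_range_idempotent[OF T idem])
  \<comment> \<open>Here \<open>T v\<close> is the component of \<open>z\<close> in the range. One
    \<open>v\<close> serves all \<open>t\<close>, since \<open>T t\<close> is orthogonal to
    \<open>N\<close> and does not affect the projection.\<close>
  have proj: "\<exists>v. \<forall>t. orth_proj N (z + T t) = z - T v" for z
  proof -
    obtain v where v: "\<And>a. a \<in> range T \<Longrightarrow> cinner (z - T v) a = 0"
      using orthogonal_decomposition[OF range, of z] by (metis imageE)
    have "z - T v \<in> N"
      using v cinner_commute[of _ "z - T v"] by (simp add: N)
    then have "orth_proj N (z + T t) = z - T v" for t
      by (rule orth_proj_eqI[OF subN]) (simp add: N cinner_diff_left cinner_add_left)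
    then show ?thesis
      by blast
  qed
  have proj0: "\<exists>v. orth_proj N z = z - T v" for z
    using proj[of z] by (metis add_0_right zero)
  have inj: "inj_on (orth_proj N) (null_space T)"
  proof (rule inj_onI)
    fix a b
    assume a: "a \<in> null_space T" and b: "b \<in> null_space T" and eq: "orth_proj N a = orth_proj N b"
    obtain v where v: "orth_proj N a = a - T v"
      using proj0 by blast
    obtain w where w: "orth_proj N b = b - T w"
      using proj0 by blast
    \<comment> \<open>The difference lies in the range, so \<open>T\<close> fixes it; being in the
      null space as well, it vanishes.\<close>
    have ab: "a - b = T (v - w)"
      using v w eq by (simp add: diff algebra_simps)
    then have "a - b = T (a - b)"
      by (simp add: TT)
    then show "a = b"
      using a b by (simp add: diff null_space_def)
  qed
  have "x - T x \<in> null_space T"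
    by (simp add: null_space_def diff TT)
  \<comment> \<open>Compare \<open>t = 0\<close> with \<open>t = x\<close> in
    \<open>proj\<close>.\<close>
  moreover have "orth_proj N (x - T x) = orth_proj N x"
    using proj[of "x - T x"] by (metis add_0_right diff_add_cancel zero)
  ultimately show ?thesis
    unfolding restricted_inverse_proj_def Let_def N_def[symmetric]
    by (simp add: the_inv_into_f_eq[OF inj])
qed

theorem theorem1p2:
  fixes T :: "'h::chilbert_space \<Rightarrow> 'h" and S :: "'h set"
  assumes "separable_space (euclidean :: 'h topology)"
    and "bounded_clinear T"
    and "idempotent T"
    and "closed_csubspace S"
  shows "invariant_under S T \<longleftrightarrow> invariant_under S (restricted_inverse_proj T)"
proof -
  \<comment> \<open>Either of \<open>T x\<close> and \<open>x - T x\<close> is \<open>x\<close>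
    minus the other, so closure under differences gives both directions.\<close>
  have "T x \<in> S \<longleftrightarrow> x - T x \<in> S" if "x \<in> S" for x
    using assms(4) that complex_vector.subspace_diff[of S x "T x"]
      complex_vector.subspace_diff[of S x "x - T x"]
    by (auto simp: closed_csubspace_def)
  then show ?thesis
    by (auto simp: invariant_under_def restricted_inverse_proj_idempotent[OF assms(2,3)])
qed

end
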